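(* Let $\mathcal{A}$ be a finite-dimensional descendingly alternative algebra over an arbitrary field $\mathbb{F}$, and let $n = l(\mathcal{A})$ be its length. If $n \geq 2$, then $\dim \mathcal{A} - d_0 \geq 2^{n-1} + n - 2$.
   Context: $\mathcal{A}$ is a finite-dimensional algebra over a field $\mathbb{F}$ (a vector space with a bilinear product), possibly non-unital and non-associative. If $\mathcal{A}$ is unital, its unity is denoted by $e$. For $S \subseteq \mathcal{A}$ and $k\ge 1$, a word of length $k$ in $S$ is any product of $k$ elements of $S$, with any arrangement of brackets. If $\mathcal{A}$ is unital, $e$ is a word of length $0$; otherwise there are no words of length $0$. $S^k$ is the set of all words in $S$ of length at most $k$. $\mathcal{L}(X)$ denotes the linear span of $X$, $\mathcal{L}_k(S) = \mathcal{L}(S^k)$ for $k\ge 0$, and $\mathcal{L}_\infty(S) = \bigcup_{k\ge 0}\mathcal{L}_k(S)$. $S$ is generating for $\mathcal{A}$ if $\mathcal{L}_\infty(S)=\mathcal{A}$. The length of $S$ is $l(S) = \min\{k : \mathcal{L}_k(S)=\mathcal{L}_\infty(S)\}$, and the length of $\mathcal{A}$ is $l(\mathcal{A}) = \max\{l(S) : \mathcal{L}_\infty(S)=\mathcal{A}\}$. Set $d_0 = 1$ if $\mathcal{A}$ is unital, and $d_0 = 0$ otherwise. For $a,b,c\in\mathcal{A}$ let $\mathcal{L}'_2(a,b,c)$ be the span of $a,b,c,ab,ba,cb,bc,ac,ca$ (together with $e$ if $\mathcal{A}$ is unital), and let $\mathcal{L}_1(a,b,aa,ab,ba)$ be the span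 of $a,b,aa,ab,ba$ (together with $e$ if $\mathcal{A}$ is unital). $\mathcal{A}$ is descendingly alternative if for all $a,b,c\in\mathcal{A}$: $(ba)a,\ a(ab) \in \mathcal{L}_1(a,b,aa,ab,ba)$; $(ab)c+(ac)b\in\mathcal{L}'_2(a,b,c)$; and $a(bc)+b(ac)\in\mathcal{L}'_2(a,b,c)$. *)

theory Defs
  imports Complex_Main
begin

text \<open>
  An algebra over a field: a vector space, whose carrier is a whole type, with a bilinear
  product that need be neither associative nor unital.
\<close>

locale nonassoc_algebra = vector_space scale
  for scale :: "'f::field \<Rightarrow> 'a::ab_group_add \<Rightarrow> 'a"  (infixr \<open>*s\<close> 75) +
  fixes mult :: "'a \<Rightarrow> 'a \<Rightarrow> 'a"  (infixl \<open>\<odot>\<close> 70)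
  assumes linear_mult_right: "Vector_Spaces.linear scale scale (\<lambda>b. a \<odot> b)"
    and linear_mult_left: "Vector_Spaces.linear scale scale (\<lambda>a. a \<odot> b)"
begin

definition is_unity :: "'a \<Rightarrow> bool"
  where "is_unity e \<longleftrightarrow> (\<forall>a. e \<odot> a = a \<and> a \<odot> e = a)"

text \<open>The set \<open>{e}\<close> if the algebra has the unity \<open>e\<close>, and the empty set otherwise.\<close>

definition unities :: "'a set"
  where "unities = {e. is_unity e}"

definition unital :: bool
  where "unital \<longleftrightarrow> (\<exists>e. is_unity e)"

definition d0 :: nat
  where "d0 = (if unital then 1 else 0)"

text \<open>
  \<open>is_word S k w\<close>: \<open>w\<close> is a word of length \<open>k\<close> in \<open>S\<close>. The same element may be a word of
  several lengths. The side conditions in the product rule keep the unity, as the word of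
  length 0, from being used as a factor.
\<close>

inductive is_word :: "'a set \<Rightarrow> nat \<Rightarrow> 'a \<Rightarrow> bool" for S :: "'a set"
  where
    unity: "is_unity e \<Longrightarrow> is_word S 0 e"
  | letter: "a \<in> S \<Longrightarrow> is_word S 1 a"
  | product: "is_word S i u \<Longrightarrow> is_word S j v \<Longrightarrow> i \<ge> 1 \<Longrightarrow> j \<ge> 1 \<Longrightarrow> is_word S (i + j) (u \<odot> v)"

definition words_upto :: "'a set \<Rightarrow> nat \<Rightarrow> 'a set"
  where "words_upto S k = {w. \<exists>j\<le>k. is_word S j w}"

definition L :: "nat \<Rightarrow> 'a set \<Rightarrow> 'a set"
  where "L k S = span (words_upto S k)"

definition L_infty :: "'a set \<Rightarrow> 'a set"
  where "L_infty S = (\<Union>k. L k S)"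

definition generating :: "'a set \<Rightarrow> bool"
  where "generating S \<longleftrightarrow> L_infty S = UNIV"

definition set_length :: "'a set \<Rightarrow> nat"
  where "set_length S = (LEAST k. L k S = L_infty S)"

text \<open>
  The maximum exists in the finite-dimensional case: whenever \<open>L k S = L (2 * k) S\<close> with
  \<open>k \<ge> 1\<close>, the chain is stationary from \<open>k\<close> on, so the lengths of the generating sets are
  bounded in terms of the dimension.
\<close>

definition alg_length :: nat
  where "alg_length = Max {set_length S | S. generating S}"

definition L2' :: "'a \<Rightarrow> 'a \<Rightarrow> 'a \<Rightarrow> 'a set"
  where "L2' a b c =
    span ({a, b, c, a \<odot> b, b \<odot> a, c \<odot> b, b \<odot> c, a \<odot> c, c \<odot> a} \<union> unities)"

definition L1_pair :: "'a \<Rightarrow> 'a \<Rightarrow> 'a set"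
  where "L1_pair a b = span ({a, b, a \<odot> a, a \<odot> b, b \<odot> a} \<union> unities)"

definition descendingly_alternative :: bool
  where "descendingly_alternative \<longleftrightarrow>
    (\<forall>a b c.
      (b \<odot> a) \<odot> a \<in> L1_pair a b \<and>
      a \<odot> (a \<odot> b) \<in> L1_pair a b \<and>
      (a \<odot> b) \<odot> c + (a \<odot> c) \<odot> b \<in> L2' a b c \<and>
      a \<odot> (b \<odot> c) + b \<odot> (a \<odot> c) \<in> L2' a b c)"

end

end

theory Submission
  imports Defs "HOL-Library.Multiset"
begin

text \<open>
  Modulo words of smaller length, left multiplications by letters anticommute and square to
  zero, so do right multiplications, and left multiplications commute with right ones on
  products. Hence every word of length \<open>m \<ge> 2\<close> is, up to sign and lower terms, of the form
  \<open>a\<^sub>1(a\<^sub>2(\<dots>((((a\<^sub>p b\<^sub>q) \<dots>) b\<^sub>2) b\<^sub>1)))\<close> with \<open>p, q \<ge> 1\<close> and \<open>p + q = m\<close>, which alternates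
  both in the \<open>a\<^sub>i\<close> and in the \<open>b\<^sub>j\<close>. Take such a word of length \<open>n\<close> outside \<open>L\<^bsub>n-1\<^esub>(S)\<close>.
  Completing a subword to the full word by the missing multiplications kills every other
  subword of at most the same length modulo \<open>L\<^bsub>n-1\<^esub>(S)\<close>. So the \<open>(2\<^sup>p - 1)(2\<^sup>q - 1)\<close> subwords
  given by nonempty subsets of the \<open>a\<^sub>i\<close> and of the \<open>b\<^sub>j\<close>, together with \<open>max p q\<close> letters and
  the unity, are linearly independent; the count is smallest for \<open>p = 1\<close> or \<open>q = 1\<close>.
\<close>

section \<open>Permutations, triangular independence and an inequality\<close>

text \<open>Induction on \<open>xs\<close>: its head occurs somewhere in \<open>ys\<close>, and
  adjacent swaps carry it there (\<open>move\<close>). The prefix \<open>ps\<close> holds the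
  letters already placed, since \<open>R\<close> is not assumed to respect prepending.\<close>

lemma mset_eq_adjacent_swaps_induct:
  assumes refl: "\<And>xs. R xs xs"
    and trans: "\<And>xs ys zs. R xs ys \<Longrightarrow> R ys zs \<Longrightarrow> R xs zs"
    and swap: "\<And>xs a b ys. R (xs @ a # b # ys) (xs @ b # a # ys)"
    and "mset xs = mset ys"
  shows "R xs ys"
proof -
  have move: "R (ps @ x # ys1 @ ys2) (ps @ ys1 @ x # ys2)" for ps x ys1 ys2
  proof (induction ys1 arbitrary: ps)
    case Nil
    then show ?case by (simp add: refl)
  next
    case (Cons y ys1)
    from Cons[of "ps @ [y]"] swap[of ps x y "ys1 @ ys2"] trans show ?case by simp
  qed
  have "R (ps @ xs) (ps @ ys)" for ps
    using \<open>mset xs = mset ys\<close>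
  proof (induction xs arbitrary: ys ps)
    case Nil
    then show ?case using refl by simp
  next
    case (Cons x xs)
    then have "x \<in> set ys" by (metis list.set_intros(1) mset_eq_setD)
    then obtain ys1 ys2 where ys: "ys = ys1 @ x # ys2" by (meson split_list)
    with Cons.prems have "mset xs = mset (ys1 @ ys2)" by simp
    from Cons.IH[OF this, of "ps @ [x]"] have "R (ps @ x # xs) (ps @ x # ys1 @ ys2)" by simp
    then show ?case using move trans ys by blast
  qed
  from this[of "[]"] show ?thesis by simp
qed

text \<open>A vector of largest degree is separated by its \<open>U\<close> from the span of all the
  others, so it can be split off and the rest treated by induction. Injectivity is proved along with
  independence because the count is over indices.\<close>

lemma (in finite_dimensional_vector_space) card_le_dim_triangular:
  fixes w :: "'i \<Rightarrow> 'b" and d :: "'i \<Rightarrow> nat"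
  assumes "finite I"
    and "\<And>i. i \<in> I \<Longrightarrow> \<exists>U. subspace U \<and> w i \<notin> U \<and> (\<forall>j\<in>I. j \<noteq> i \<longrightarrow> d j \<le> d i \<longrightarrow> w j \<in> U)"
  shows "card I \<le> dim UNIV"
proof -
  have "inj_on w I \<and> independent (w ` I)"
    using assms
  proof (induction "card I" arbitrary: I)
    case 0
    then show ?case by (simp add: independent_empty)
  next
    case (Suc k)
    then have "I \<noteq> {}" by auto
    then obtain i where "i \<in> I" "d i = Max (d ` I)"
      using Suc.prems(1) Max_in[of "d ` I"] by fastforce
    then have i: "i \<in> I" "\<forall>j\<in>I. d j \<le> d i"
      using Suc.prems(1) by auto
    let ?I = "I - {i}"
    have IH: "inj_on w ?I \<and> independent (w ` ?I)"
    proof (rule Suc.hyps(1))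
      show "\<exists>U. subspace U \<and> w i' \<notin> U \<and> (\<forall>j\<in>?I. j \<noteq> i' \<longrightarrow> d j \<le> d i' \<longrightarrow> w j \<in> U)"
        if "i' \<in> ?I" for i'
        using Suc.prems(2)[of i'] that by blast
    qed (use Suc i in auto)
    obtain U where U: "subspace U" "w i \<notin> U" "\<forall>j\<in>I. j \<noteq> i \<longrightarrow> d j \<le> d i \<longrightarrow> w j \<in> U"
      using Suc.prems(2) i(1) by blast
    have "span (w ` ?I) \<subseteq> U" by (rule span_minimal) (use U i in auto)
    then have "w i \<notin> span (w ` ?I)" using U by blast
    then have "w i \<notin> w ` ?I" "independent (insert (w i) (w ` ?I))"
      using span_base[of "w i" "w ` ?I"] independent_insertI[of "w i" "w ` ?I"] IH by argo+
    with IH have "inj_on w (insert i ?I) \<and> independent (w ` insert i ?I)"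
      by (simp del: insert_Diff_single)
    then show ?case using i by (simp add: insert_absorb)
  qed
  then show ?thesis
    using independent_card_le_dim[of "w ` I" UNIV] card_image by fastforce
qed

text \<open>Equality holds at \<open>p = 1\<close>. Raising \<open>p\<close> by one doubles both
  sides and then adds \<open>2 ^ q - 1\<close>, at least 3, on the right against
  \<open>3 - p\<close> on the left.\<close>

lemma length_count_bound_aux:
  fixes p q :: nat
  assumes "1 \<le> p" "2 \<le> q"
  shows "2 ^ (p + q - 1) + int p - 2 \<le> (2 ^ p - 1) * (2 ^ q - 1)"
  using assms(1)
proof (induction p rule: dec_induct)
  case base
  then show ?case by simp
next
  case (step p)
  have "(2::int) ^ 2 \<le> 2 ^ q"
    using assms by (intro power_increasing) auto
  moreover have "(2::int) ^ (Suc p + q - 1) = 2 * 2 ^ (p + q - 1)"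
    using step by (simp flip: power_Suc)
  moreover have "((2::int) ^ Suc p - 1) * (2 ^ q - 1) = 2 * ((2 ^ p - 1) * (2 ^ q - 1)) + (2 ^ q - 1)"
    by (simp add: algebra_simps)
  ultimately show ?case using step by simp
qed

text \<open>For \<open>p \<le> q\<close> this is the auxiliary bound with \<open>q\<close> added to
  both sides; the opposite case is symmetric. For \<open>p = q = 1\<close> both sides equal
  2.\<close>

lemma length_count_bound:
  fixes p q :: nat
  assumes "1 \<le> p" "1 \<le> q"
  shows "2 ^ (p + q - 1) + int (p + q) - 2 \<le> (2 ^ p - 1) * (2 ^ q - 1) + int (max p q)"
proof (cases "p = 1 \<and> q = 1")
  case True
  then show ?thesis by simp
next
  case False
  show ?thesis
  proof (cases "p \<le> q")
    case True
    with False assms have "2 \<le> q" by linarith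
    then show ?thesis using length_count_bound_aux[of p q] True assms by simp
  next
    case False
    then show ?thesis using length_count_bound_aux[of q p] assms by (simp add: mult.commute add.commute)
  qed
qed

section \<open>The filtration by word length\<close>

context nonassoc_algebra
begin

lemma linear_add_scale:
  assumes "Vector_Spaces.linear scale scale f"
  shows "f (x + y) = f x + f y" "f (c *s x) = c *s f x"
  using assms by (auto simp: Vector_Spaces.linear_iff)

lemmas mult_add_right = linear_add_scale(1)[OF linear_mult_right]
lemmas mult_add_left = linear_add_scale(1)[OF linear_mult_left]
lemmas mult_scale_right = linear_add_scale(2)[OF linear_mult_right]
lemmas mult_scale_left = linear_add_scale(2)[OF linear_mult_left]

lemma mult_zero_right: "a \<odot> 0 = 0"
  using mult_scale_right[of a 0 0] by simp

lemma mult_zero_left: "0 \<odot> a = 0"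
  using mult_scale_left[of 0 0 a] by simp

lemma mult_diff_right: "a \<odot> (x - y) = a \<odot> x - a \<odot> y"
  using mult_add_right[of a "x - y" y] by (simp add: algebra_simps)

lemma mult_diff_left: "(x - y) \<odot> a = x \<odot> a - y \<odot> a"
  using mult_add_left[of "x - y" y a] by (simp add: algebra_simps)

lemma subspace_vimage_mult_right: "subspace V \<Longrightarrow> subspace {x. a \<odot> x \<in> V}"
  by (auto simp: subspace_def mult_add_right mult_scale_right mult_zero_right)

lemma subspace_vimage_mult_left: "subspace V \<Longrightarrow> subspace {x. x \<odot> a \<in> V}"
  by (auto simp: subspace_def mult_add_left mult_scale_left mult_zero_left)

lemma subspace_L: "subspace (L k S)"
  by (simp add: L_def)

lemma is_word_imp_L: "is_word S k w \<Longrightarrow> w \<in> L k S"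
  by (auto simp: L_def words_upto_def intro: span_base)

lemma L_mono: "j \<le> k \<Longrightarrow> L j S \<subseteq> L k S"
  unfolding L_def words_upto_def by (intro span_mono) (auto intro: le_trans)

lemma L_1I: "a \<in> S \<Longrightarrow> a \<in> L 1 S"
  by (intro is_word_imp_L is_word.letter)

lemma unities_subset_L: "unities \<subseteq> L k S"
  using L_mono[of 0 k S] is_word_imp_L[OF is_word.unity, of _ S] by (auto simp: unities_def)

lemma is_word_0: "is_word S 0 w \<longleftrightarrow> is_unity w"
  by (auto elim: is_word.cases intro: is_word.unity)

lemma is_word_1: "is_word S (Suc 0) w \<longleftrightarrow> w \<in> S"
proof
  show "w \<in> S" if "is_word S (Suc 0) w"
    using that by cases auto
qed (use is_word.letter in auto)

text \<open>The rule \<open>is_word.product\<close> excludes factors of length 0, but such a factor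
  is the unity and changes neither the other factor nor the sum of the lengths.\<close>

lemma is_word_mult_L:
  assumes "is_word S i u" "is_word S j v"
  shows "u \<odot> v \<in> L (i + j) S"
proof (cases "i = 0 \<or> j = 0")
  case True
  then show ?thesis
    using assms by (auto simp: is_word_0 is_unity_def intro: is_word_imp_L)
next
  case False
  then show ?thesis
    using assms is_word.product[of S i u j v] is_word_imp_L by auto
qed

text \<open>Two linear extensions: first in the right factor with the left one a fixed word, then in
  the left factor.\<close>

lemma L_mult:
  assumes "u \<in> L i S" "v \<in> L j S"
  shows "u \<odot> v \<in> L (i + j) S"
proof -
  have words: "u \<odot> v \<in> L (i + j) S" if "u \<in> words_upto S i" "v \<in> words_upto S j" for u v
  proof -
    from that obtain i' j' where "i' \<le> i" "is_word S i' u" "j' \<le> j" "is_word S j' v"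
      by (auto simp: words_upto_def)
    then show ?thesis using is_word_mult_L[of S i' u j' v] L_mono[of "i' + j'" "i + j" S] by auto
  qed
  have "span (words_upto S j) \<subseteq> {v. u \<odot> v \<in> L (i + j) S}" if "u \<in> words_upto S i" for u
    by (rule span_minimal) (use words that in \<open>auto intro: subspace_vimage_mult_right subspace_L\<close>)
  then have "span (words_upto S i) \<subseteq> {u. u \<odot> v \<in> L (i + j) S}"
    using assms(2) by (intro span_minimal subspace_vimage_mult_left subspace_L) (auto simp: L_def)
  then show ?thesis using assms(1) by (auto simp: L_def)
qed

lemma L_mult_le: "u \<in> L i S \<Longrightarrow> v \<in> L j S \<Longrightarrow> i + j \<le> k \<Longrightarrow> u \<odot> v \<in> L k S"
  using L_mult L_mono by blast

end

section \<open>Swaps and squares modulo lower terms\<close>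

locale descendingly_alternative_algebra = nonassoc_algebra scale mult
  for scale :: "'f::field \<Rightarrow> 'a::ab_group_add \<Rightarrow> 'a"  (infixr \<open>*s\<close> 75)
    and mult :: "'a \<Rightarrow> 'a \<Rightarrow> 'a"  (infixl \<open>\<odot>\<close> 70) +
  fixes S :: "'a set"
  assumes desc_alt: "descendingly_alternative"
begin

text \<open>Each generator of \<open>L2' a b c\<close> omits at least one of the three factors, and
  every factor has positive degree, so it lies below the degree \<open>i + j + k\<close> of the
  triple product. Thus the defining relations become sign rules modulo lower terms. Writing
  \<open>Suc m\<close> avoids a truncated subtraction.\<close>

lemma L2'_subset:
  assumes "a \<in> L i S" "b \<in> L j S" "c \<in> L k S" "1 \<le> i" "1 \<le> j" "1 \<le> k" "i + j + k \<le> Suc m"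
  shows "L2' a b c \<subseteq> L m S"
  unfolding L2'_def using assms unities_subset_L[of m S]
  by (intro span_minimal subspace_L) (auto intro: L_mult_le L_mono[THEN subsetD, rotated])

lemma L1_pair_subset:
  assumes "a \<in> L i S" "b \<in> L j S" "1 \<le> i" "1 \<le> j" "i + i + j \<le> Suc m"
  shows "L1_pair a b \<subseteq> L m S"
  unfolding L1_pair_def using assms unities_subset_L[of m S]
  by (intro span_minimal subspace_L) (auto intro: L_mult_le L_mono[THEN subsetD, rotated])

lemma right_square:
  assumes "a \<in> L i S" "b \<in> L j S" "1 \<le> i" "1 \<le> j" "i + i + j \<le> Suc m"
  shows "(b \<odot> a) \<odot> a \<in> L m S"
  using L1_pair_subset[OF assms] desc_alt by (auto simp: descendingly_alternative_def)

lemma left_square: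
  assumes "a \<in> L i S" "b \<in> L j S" "1 \<le> i" "1 \<le> j" "i + i + j \<le> Suc m"
  shows "a \<odot> (a \<odot> b) \<in> L m S"
  using L1_pair_subset[OF assms] desc_alt by (auto simp: descendingly_alternative_def)

text \<open>Congruence up to sign modulo \<open>L m S\<close>; words of length \<open>m + 1\<close> are compared by \<open>sim m\<close>.\<close>

definition sim :: "nat \<Rightarrow> 'a \<Rightarrow> 'a \<Rightarrow> bool"
  where "sim m u v \<longleftrightarrow> u - v \<in> L m S \<or> u + v \<in> L m S"

lemma sim_refl: "sim m u u"
  by (simp add: sim_def subspace_L subspace_0)

lemma sim_sym: "sim m u v \<Longrightarrow> sim m v u"
  using subspace_neg[OF subspace_L, of "u - v" m S] by (auto simp: sim_def add.commute)

lemma sim_trans: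
  assumes "sim m u v" "sim m v w"
  shows "sim m u w"
proof -
  have "u - w = (u - v) + (v - w)" "u + w = (u - v) + (v + w)" "u + w = (u + v) - (v - w)"
    "u - w = (u + v) - (v + w)"
    by (auto simp: algebra_simps)
  then show ?thesis
    using assms subspace_add[OF subspace_L] subspace_diff[OF subspace_L] unfolding sim_def by metis
qed

lemma sim_in_L: "sim m u v \<Longrightarrow> v \<in> L m S \<Longrightarrow> u \<in> L m S"
  using subspace_add[OF subspace_L, of "u - v" m S v] subspace_diff[OF subspace_L, of "u + v" m S v]
  by (auto simp: sim_def)

lemma sim_mult_left:
  assumes "sim m u v" "a \<in> S"
  shows "sim (Suc m) (a \<odot> u) (a \<odot> v)"
  using L_mult[OF L_1I[OF assms(2)], of "u - v" m] L_mult[OF L_1I[OF assms(2)], of "u + v" m] assms(1)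
  by (auto simp: sim_def mult_add_right mult_diff_right)

lemma sim_mult_right:
  assumes "sim m u v" "a \<in> S"
  shows "sim (Suc m) (u \<odot> a) (v \<odot> a)"
  using L_mult[OF _ L_1I[OF assms(2)], of "u - v" m] L_mult[OF _ L_1I[OF assms(2)], of "u + v" m] assms(1)
  by (auto simp: sim_def mult_add_left mult_diff_left)

lemma right_swap:
  assumes "a \<in> L i S" "b \<in> L j S" "c \<in> L k S" "1 \<le> i" "1 \<le> j" "1 \<le> k" "i + j + k \<le> Suc m"
  shows "sim m ((a \<odot> b) \<odot> c) ((a \<odot> c) \<odot> b)"
  using L2'_subset[OF assms] desc_alt by (auto simp: descendingly_alternative_def sim_def)

lemma left_swap:
  assumes "a \<in> L i S" "b \<in> L j S" "c \<in> L k S" "1 \<le> i" "1 \<le> j" "1 \<le> k" "i + j + k \<le> Suc m"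
  shows "sim m (a \<odot> (b \<odot> c)) (b \<odot> (a \<odot> c))"
  using L2'_subset[OF assms] desc_alt by (auto simp: descendingly_alternative_def sim_def)

text \<open>Left and right multiplications are commuted by moving them past the two factors of
  \<open>u\<close>, so this factorization is what the argument needs. The factors range over the
  filtration rather than over words, and \<open>k\<close> is a nominal degree.\<close>

definition is_product :: "nat \<Rightarrow> 'a \<Rightarrow> bool"
  where "is_product k u \<longleftrightarrow> (\<exists>i j x y. 1 \<le> i \<and> 1 \<le> j \<and> i + j = k \<and> x \<in> L i S \<and> y \<in> L j S \<and> u = x \<odot> y)"

lemma is_product_in_L: "is_product k u \<Longrightarrow> u \<in> L k S"
  by (auto simp: is_product_def intro: L_mult)

lemma is_product_pos: "is_product k u \<Longrightarrow> 2 \<le> k"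
  by (auto simp: is_product_def)

lemma is_product_letters: "x \<in> S \<Longrightarrow> y \<in> S \<Longrightarrow> is_product 2 (x \<odot> y)"
  unfolding is_product_def using L_1I by (intro exI[of _ 1]) auto

lemma is_product_mult_left:
  assumes "a \<in> S" "is_product k u"
  shows "is_product (Suc k) (a \<odot> u)"
  using L_1I[OF assms(1)] is_product_in_L[OF assms(2)] is_product_pos[OF assms(2)]
  unfolding is_product_def by (intro exI[of _ 1] exI[of _ k] exI[of _ a] exI[of _ u]) auto

lemma is_product_mult_right:
  assumes "a \<in> S" "is_product k u"
  shows "is_product (Suc k) (u \<odot> a)"
  using L_1I[OF assms(1)] is_product_in_L[OF assms(2)] is_product_pos[OF assms(2)]
  unfolding is_product_def by (intro exI[of _ k] exI[of _ 1] exI[of _ u] exI[of _ a]) auto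

text \<open>For \<open>u = x \<odot> y\<close>, both sides reduce to \<open>(x \<odot> b) \<odot> (a \<odot> y)\<close>.\<close>

lemma sim_left_right_commute:
  assumes "a \<in> S" "b \<in> S" "is_product k u"
  shows "sim (Suc k) ((a \<odot> u) \<odot> b) (a \<odot> (u \<odot> b))"
proof -
  obtain i j x y where u: "1 \<le> i" "1 \<le> j" "i + j = k" "x \<in> L i S" "y \<in> L j S" "u = x \<odot> y"
    using assms(3) by (auto simp: is_product_def)
  note ab = L_1I[OF assms(1)] L_1I[OF assms(2)]
  have ay: "a \<odot> y \<in> L (1 + j) S" and xb: "x \<odot> b \<in> L (i + 1) S"
    using ab u by (auto intro!: L_mult simp del: One_nat_def plus_1_eq_Suc)
  have "sim (Suc k) ((a \<odot> (x \<odot> y)) \<odot> b) ((x \<odot> (a \<odot> y)) \<odot> b)"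
    using ab u by (intro sim_mult_right assms left_swap[where i = 1 and j = i and k = j]) auto
  moreover have "sim (Suc k) ((x \<odot> (a \<odot> y)) \<odot> b) ((x \<odot> b) \<odot> (a \<odot> y))"
    using ab u ay by (intro right_swap[where i = i and j = "1 + j" and k = 1]) auto
  moreover have "sim (Suc k) ((x \<odot> b) \<odot> (a \<odot> y)) (a \<odot> ((x \<odot> b) \<odot> y))"
    using ab u xb by (intro left_swap[where i = "i + 1" and j = 1 and k = j]) auto
  moreover have "sim (Suc k) (a \<odot> ((x \<odot> b) \<odot> y)) (a \<odot> ((x \<odot> y) \<odot> b))"
    using ab u by (intro sim_mult_left assms right_swap[where i = i and j = 1 and k = j]) auto
  ultimately show ?thesis using u(6) sim_trans by blast
qed

section \<open>Iterated multiplications and alternating words\<close>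

abbreviation lmul :: "'a list \<Rightarrow> 'a \<Rightarrow> 'a"
  where "lmul as u \<equiv> foldr (\<lambda>a u. a \<odot> u) as u"

abbreviation rmul :: "'a list \<Rightarrow> 'a \<Rightarrow> 'a"
  where "rmul bs u \<equiv> foldr (\<lambda>b u. u \<odot> b) bs u"

lemma subspace_vimage_lmul: "subspace V \<Longrightarrow> subspace {u. lmul as u \<in> V}"
proof (induction as arbitrary: V)
  case (Cons a as)
  then show ?case using Cons.IH[OF subspace_vimage_mult_right, of V a] by simp
qed simp

lemma subspace_vimage_rmul: "subspace V \<Longrightarrow> subspace {u. rmul bs u \<in> V}"
proof (induction bs arbitrary: V)
  case (Cons b bs)
  then show ?case using Cons.IH[OF subspace_vimage_mult_left, of V b] by simp
qed simp

lemma lmul_in_L: "set as \<subseteq> S \<Longrightarrow> u \<in> L k S \<Longrightarrow> lmul as u \<in> L (length as + k) S"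
  by (induction as) (auto intro!: L_mult_le[where i = 1] L_1I simp del: One_nat_def)

lemma rmul_in_L: "set bs \<subseteq> S \<Longrightarrow> u \<in> L k S \<Longrightarrow> rmul bs u \<in> L (length bs + k) S"
  by (induction bs) (auto intro!: L_mult_le[where j = 1] L_1I simp del: One_nat_def)

lemma sim_lmul: "set as \<subseteq> S \<Longrightarrow> sim m u v \<Longrightarrow> sim (length as + m) (lmul as u) (lmul as v)"
  by (induction as) (auto intro: sim_mult_left)

lemma sim_rmul: "set bs \<subseteq> S \<Longrightarrow> sim m u v \<Longrightarrow> sim (length bs + m) (rmul bs u) (rmul bs v)"
  by (induction bs) (auto intro: sim_mult_right)

lemma is_product_lmul: "set as \<subseteq> S \<Longrightarrow> is_product k u \<Longrightarrow> is_product (length as + k) (lmul as u)"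
  by (induction as) (auto intro: is_product_mult_left)

lemma is_product_rmul: "set bs \<subseteq> S \<Longrightarrow> is_product k u \<Longrightarrow> is_product (length bs + k) (rmul bs u)"
  by (induction bs) (auto intro: is_product_mult_right)

text \<open>The letter \<open>a\<close> passes one right multiplication at a time; each intermediate
  element is still a product by \<open>is_product_rmul\<close>.\<close>

lemma sim_mult_rmul_commute:
  assumes "a \<in> S" "set bs \<subseteq> S" "is_product k u"
  shows "sim (length bs + k) (a \<odot> rmul bs u) (rmul bs (a \<odot> u))"
  using assms(2)
proof (induction bs)
  case Nil
  then show ?case by (simp add: sim_refl)
next
  case (Cons b bs)
  then have "sim (Suc (length bs + k)) (a \<odot> (rmul bs u \<odot> b)) ((a \<odot> rmul bs u) \<odot> b)"
    using assms by (intro sim_sym[OF sim_left_right_commute] is_product_rmul) auto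
  moreover have "sim (Suc (length bs + k)) ((a \<odot> rmul bs u) \<odot> b) (rmul bs (a \<odot> u) \<odot> b)"
    using Cons by (intro sim_mult_right) auto
  ultimately have "sim (Suc (length bs + k)) (a \<odot> (rmul bs u \<odot> b)) (rmul bs (a \<odot> u) \<odot> b)"
    by (rule sim_trans)
  then show ?case by simp
qed

text \<open>The degree of \<open>u\<close> is written \<open>Suc k\<close> so that the modulus, one
  below the total degree, needs no subtraction.\<close>

lemma sim_lmul_rmul_commute:
  assumes "set as \<subseteq> S" "set bs \<subseteq> S" "is_product (Suc k) u"
  shows "sim (length as + length bs + k) (lmul as (rmul bs u)) (rmul bs (lmul as u))"
  using assms(1)
proof (induction as)
  case Nil
  then show ?case by (simp add: sim_refl)
next
  case (Cons a as)
  then have "sim (Suc (length as + length bs + k)) (a \<odot> lmul as (rmul bs u)) (a \<odot> rmul bs (lmul as u))"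
    by (intro sim_mult_left) auto
  moreover have "sim (length bs + (length as + Suc k)) (a \<odot> rmul bs (lmul as u)) (rmul bs (a \<odot> lmul as u))"
    using Cons assms by (intro sim_mult_rmul_commute is_product_lmul) auto
  then have "sim (Suc (length as + length bs + k)) (a \<odot> rmul bs (lmul as u)) (rmul bs (a \<odot> lmul as u))"
    by (simp add: add_ac)
  ultimately have "sim (Suc (length as + length bs + k)) (a \<odot> lmul as (rmul bs u)) (rmul bs (a \<odot> lmul as u))"
    by (rule sim_trans)
  then show ?case by simp
qed

text \<open>
  The last elements of the two lists form the innermost product. With this convention the word
  is alternating in each list as a whole.
\<close>

definition altword :: "'a list \<Rightarrow> 'a list \<Rightarrow> 'a"
  where "altword l r = lmul (butlast l) (rmul (butlast r) (last l \<odot> last r))"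

lemma altword_snoc: "altword (as @ [x]) (bs @ [y]) = lmul as (rmul bs (x \<odot> y))"
  by (simp add: altword_def)

lemma altword_in_L:
  assumes "set l \<subseteq> S" "set r \<subseteq> S" "l \<noteq> []" "r \<noteq> []"
  shows "altword l r \<in> L (length l + length r) S"
proof -
  obtain as x bs y where lr: "l = as @ [x]" "r = bs @ [y]"
    using assms by (metis rev_exhaust)
  have "lmul as (rmul bs (x \<odot> y)) \<in> L (length as + (length bs + (1 + 1))) S"
    using assms lr by (intro lmul_in_L rmul_in_L L_mult L_1I) auto
  then show ?thesis by (simp add: lr altword_snoc)
qed

lemma altword_append_left: "l \<noteq> [] \<Longrightarrow> altword (as @ l) r = lmul as (altword l r)"
  by (simp add: altword_def butlast_append)

lemma altword_swap_left:
  assumes "set (xs @ a # b # ys) \<subseteq> S" "set r \<subseteq> S" "r \<noteq> []"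
    and m: "length xs + length ys + length r + 1 = m"
  shows "sim m (altword (xs @ a # b # ys) r) (altword (xs @ b # a # ys) r)"
proof -
  obtain bs y where r: "r = bs @ [y]" using assms by (metis rev_exhaust)
  have S: "a \<in> S" "b \<in> S" "y \<in> S" "set xs \<subseteq> S" "set bs \<subseteq> S" using assms r by auto
  have "sim (length ys + length r + 1) (altword (a # b # ys) r) (altword (b # a # ys) r)"
  proof (cases "ys = []")
    case True
    \<comment> \<open>Here \<open>b\<close> belongs to the innermost product, so the right
      multiplications separate it from \<open>a\<close>. Move \<open>a\<close> inside them, swap
      next to \<open>y\<close>, and move \<open>b\<close> out again.\<close>
    have "sim (length bs + 2) (a \<odot> rmul bs (b \<odot> y)) (rmul bs (a \<odot> (b \<odot> y)))"
      using S by (intro sim_mult_rmul_commute is_product_letters) auto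
    moreover have "sim (length bs + 2) (rmul bs (a \<odot> (b \<odot> y))) (rmul bs (b \<odot> (a \<odot> y)))"
      using S by (intro sim_rmul left_swap[where i = 1 and j = 1 and k = 1] L_1I) auto
    moreover have "sim (length bs + 2) (rmul bs (b \<odot> (a \<odot> y))) (b \<odot> rmul bs (a \<odot> y))"
      using S by (intro sim_sym[OF sim_mult_rmul_commute] is_product_letters) auto
    ultimately have "sim (length bs + 2) (a \<odot> rmul bs (b \<odot> y)) (b \<odot> rmul bs (a \<odot> y))"
      using sim_trans by blast
    then show ?thesis
      using True altword_snoc[of "[a]" b bs y] altword_snoc[of "[b]" a bs y] by (simp add: r)
  next
    case False
    then have "sim (length ys + length r + 1) (a \<odot> (b \<odot> altword ys r)) (b \<odot> (a \<odot> altword ys r))"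
      using assms L_1I[of a] L_1I[of b]
      by (intro left_swap[where i = 1 and j = 1 and k = "length ys + length r"] altword_in_L) (auto simp: Suc_le_eq)
    then show ?thesis
      using False altword_append_left[of ys "[a, b]" r] altword_append_left[of ys "[b, a]" r] by simp
  qed
  then have "sim m (lmul xs (altword (a # b # ys) r)) (lmul xs (altword (b # a # ys) r))"
    using sim_lmul[OF S(4), of "length ys + length r + 1"] by (simp add: add.assoc flip: m)
  then show ?thesis by (simp add: altword_append_left)
qed

lemma altword_swap_right:
  assumes "set (xs @ a # b # ys) \<subseteq> S" "set l \<subseteq> S" "l \<noteq> []"
    and m: "length l + (length xs + length ys) + 1 = m"
  shows "sim m (altword l (xs @ a # b # ys)) (altword l (xs @ b # a # ys))"
proof -
  obtain as x where l: "l = as @ [x]" using assms by (metis rev_exhaust)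
  obtain u where u: "u \<in> L (length ys + 1) S"
    and eq: "altword l (xs @ a # b # ys) = lmul as (rmul xs ((u \<odot> b) \<odot> a))"
      "altword l (xs @ b # a # ys) = lmul as (rmul xs ((u \<odot> a) \<odot> b))"
  proof (cases ys rule: rev_cases)
    case Nil
    then show ?thesis
      using that[of x] assms L_1I[of x] l altword_snoc[of as x "xs @ [a]" b] altword_snoc[of as x "xs @ [b]" a]
      by simp
  next
    case (snoc ys' y)
    have "rmul ys' (x \<odot> y) \<in> L (length ys' + (1 + 1)) S"
      using assms l snoc by (intro rmul_in_L L_mult L_1I) auto
    then show ?thesis
      using that[of "rmul ys' (x \<odot> y)"] snoc l
        altword_snoc[of as x "xs @ a # b # ys'" y] altword_snoc[of as x "xs @ b # a # ys'" y] by simp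
  qed
  have "sim (length ys + 2) ((u \<odot> b) \<odot> a) ((u \<odot> a) \<odot> b)"
    using assms u by (intro right_swap[where i = "length ys + 1" and j = 1 and k = 1] L_1I) auto
  then have "sim (length as + (length xs + (length ys + 2))) (altword l (xs @ a # b # ys)) (altword l (xs @ b # a # ys))"
    unfolding eq using assms l by (intro sim_lmul sim_rmul) auto
  then show ?thesis using m l by (simp flip: m add: add_ac)
qed

lemma altword_perm_left:
  assumes "mset l = mset l'" "set l \<subseteq> S" "set r \<subseteq> S" "r \<noteq> []" "length l + length r = Suc m"
  shows "sim m (altword l r) (altword l' r)"
proof -
  \<comment> \<open>The side conditions are part of the relation: equality of multisets hands them
    on to the intermediate list, which makes the relation transitive.\<close>
  have "mset l = mset l' \<and> (set l \<subseteq> S \<longrightarrow> length l + length r = Suc m \<longrightarrow> sim m (altword l r) (altword l' r))"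
    using assms(1)
  proof (rule mset_eq_adjacent_swaps_induct[rotated 3], goal_cases)
    case (2 xs ys zs)
    then show ?case using sim_trans mset_eq_setD mset_eq_length by metis
  next
    case (3 xs a b ys)
    then show ?case using altword_swap_left[of xs a b ys r m] assms by auto
  qed (simp add: sim_refl)
  then show ?thesis using assms by blast
qed

lemma altword_perm_right:
  assumes "mset r = mset r'" "set l \<subseteq> S" "set r \<subseteq> S" "l \<noteq> []" "length l + length r = Suc m"
  shows "sim m (altword l r) (altword l r')"
proof -
  have "mset r = mset r' \<and> (set r \<subseteq> S \<longrightarrow> length l + length r = Suc m \<longrightarrow> sim m (altword l r) (altword l r'))"
    using assms(1)
  proof (rule mset_eq_adjacent_swaps_induct[rotated 3], goal_cases)
    case (2 xs ys zs)
    then show ?case using sim_trans mset_eq_setD mset_eq_length by metis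
  next
    case (3 xs a b ys)
    then show ?case using altword_swap_right[of xs a b ys l m] assms by auto
  qed (simp add: sim_refl)
  then show ?thesis using assms by blast
qed

lemma altword_perm:
  assumes "mset l = mset l'" "mset r = mset r'" "set l \<subseteq> S" "set r \<subseteq> S" "l \<noteq> []" "r \<noteq> []"
    and "length l + length r = Suc m"
  shows "sim m (altword l r) (altword l' r')"
proof -
  have "set l' \<subseteq> S" "l' \<noteq> []" "length l' = length l"
    using assms by (metis mset_eq_setD, metis mset_zero_iff, metis mset_eq_length)
  then have "sim m (altword l r) (altword l' r)" "sim m (altword l' r) (altword l' r')"
    using altword_perm_left[of l l' r m] altword_perm_right[of r r' l' m] assms by simp_all
  then show ?thesis by (rule sim_trans)
qed

lemma not_distinct_mset_eq:
  assumes "\<not> distinct xs"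
  obtains ys a where "mset xs = mset (ys @ [a, a])"
proof -
  obtain us vs ws a where "xs = us @ [a] @ vs @ [a] @ ws"
    using assms not_distinct_decomp by blast
  then have "mset xs = mset ((us @ vs @ ws) @ [a, a])" by (simp add: ac_simps)
  then show thesis using that by blast
qed

text \<open>A permutation brings the two equal letters to the innermost positions, where
  \<open>left_square\<close> or \<open>right_square\<close> applies. On the left, one of them must
  first pass the right multiplications.\<close>

lemma altword_not_distinct:
  assumes "\<not> distinct l \<or> \<not> distinct r" "set l \<subseteq> S" "set r \<subseteq> S" "l \<noteq> []" "r \<noteq> []"
    and "length l + length r = Suc m"
  shows "altword l r \<in> L m S"
  using assms(1)
proof
  assume "\<not> distinct l"
  then obtain xs a where l': "mset l = mset (xs @ [a, a])" using not_distinct_mset_eq by blast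
  obtain bs y where r: "r = bs @ [y]" using assms by (metis rev_exhaust)
  have S: "set xs \<subseteq> S" "a \<in> S" "y \<in> S" "set bs \<subseteq> S"
    using mset_eq_setD[OF l'] assms r by auto
  have m: "m = length xs + (length bs + 2)"
    using mset_eq_length[OF l'] assms(6) r by simp
  have "rmul bs (a \<odot> (a \<odot> y)) \<in> L (length bs + 2) S"
    using S by (intro rmul_in_L left_square[where i = 1 and j = 1] L_1I) auto
  moreover have "sim (length bs + 2) (a \<odot> rmul bs (a \<odot> y)) (rmul bs (a \<odot> (a \<odot> y)))"
    using S by (intro sim_mult_rmul_commute is_product_letters) auto
  ultimately have "a \<odot> rmul bs (a \<odot> y) \<in> L (length bs + 2) S" by (rule sim_in_L[rotated])
  then have "lmul xs (a \<odot> rmul bs (a \<odot> y)) \<in> L m S"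
    unfolding m by (rule lmul_in_L[OF S(1)])
  then have "altword (xs @ [a, a]) r \<in> L m S"
    using altword_snoc[of "xs @ [a]" a bs y] by (simp add: r)
  then show ?thesis using altword_perm_left[OF l'] assms sim_in_L by blast
next
  assume "\<not> distinct r"
  then obtain ys a where r': "mset r = mset (ys @ [a, a])" using not_distinct_mset_eq by blast
  obtain as x where l: "l = as @ [x]" using assms by (metis rev_exhaust)
  have S: "set ys \<subseteq> S" "a \<in> S" "x \<in> S" "set as \<subseteq> S"
    using mset_eq_setD[OF r'] assms l by auto
  have m: "m = length as + (length ys + 2)"
    using mset_eq_length[OF r'] assms(6) l by simp
  have "lmul as (rmul ys ((x \<odot> a) \<odot> a)) \<in> L m S"
    unfolding m using S by (intro lmul_in_L rmul_in_L right_square[where i = 1 and j = 1] L_1I) auto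
  then have "altword l (ys @ [a, a]) \<in> L m S"
    using altword_snoc[of as x "ys @ [a]" a] by (simp add: l)
  then show ?thesis using altword_perm_right[OF r'] assms sim_in_L by blast
qed

text \<open>Left letters are outermost in \<open>altword\<close>, so the new right multiplications
  must be commuted past them. This gives only a congruence, whereas
  \<open>altword_append_left\<close> is an equality.\<close>

lemma sim_rmul_altword:
  assumes "set bs \<subseteq> S" "set l \<subseteq> S" "set r \<subseteq> S" "l \<noteq> []" "r \<noteq> []"
    and m: "length bs + length l + length r = Suc m"
  shows "sim m (rmul bs (altword l r)) (altword l (bs @ r))"
proof -
  obtain as x cs y where lr: "l = as @ [x]" "r = cs @ [y]"
    using assms by (metis rev_exhaust)
  have "is_product (Suc (length cs + 1)) (rmul cs (x \<odot> y))"
    using is_product_rmul[OF _ is_product_letters, of cs x y] assms lr by simp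
  then have "sim (length as + length bs + (length cs + 1)) (lmul as (rmul bs (rmul cs (x \<odot> y)))) (rmul bs (lmul as (rmul cs (x \<odot> y))))"
    using assms lr by (intro sim_lmul_rmul_commute) auto
  then have "sim m (altword l (bs @ r)) (rmul bs (altword l r))"
    using m lr altword_snoc[of as x "bs @ cs" y] altword_snoc[of as x cs y]
    by (simp add: add_ac)
  then show ?thesis by (rule sim_sym)
qed

lemma sim_lmul_rmul_altword:
  assumes "set as \<subseteq> S" "set bs \<subseteq> S" "set l \<subseteq> S" "set r \<subseteq> S" "l \<noteq> []" "r \<noteq> []"
    and "length as + length bs + (length l + length r) = Suc m"
  shows "sim m (lmul as (rmul bs (altword l r))) (altword (as @ l) (bs @ r))"
proof -
  have "2 \<le> length l + length r" using assms(5,6) by (cases l; cases r) auto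
  then obtain k where k: "length bs + length l + length r = Suc k" "m = length as + k"
    using that[of "m - length as"] assms(7) by simp
  show ?thesis
    using sim_lmul[OF assms(1) sim_rmul_altword[OF assms(2-6) k(1)]] assms k(2)
    by (simp add: altword_append_left)
qed

section \<open>Reduction of words to alternating form\<close>

lemma is_word_productE:
  assumes "is_word S k w" "2 \<le> k"
  obtains i j u v where "is_word S i u" "is_word S j v" "1 \<le> i" "1 \<le> j" "i + j = k" "w = u \<odot> v"
  using assms by cases auto

text \<open>Induction on the degree of the left factor. For \<open>u = a \<odot> b\<close>,
  \<open>right_swap\<close> gives \<open>(a \<odot> v) \<odot> b\<close>, which settles the case of
  a letter \<open>b\<close>. For \<open>b = c \<odot> d\<close>, \<open>left_swap\<close> turns this
  into \<open>c \<odot> ((a \<odot> v) \<odot> d)\<close>, whose left factor \<open>c\<close> is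
  shorter than \<open>u\<close>.\<close>

lemma product_of_words_sim_mult_letter:
  assumes "is_word S i u" "is_word S j v" "1 \<le> i" "1 \<le> j" "i + j = Suc m"
  shows "\<exists>a\<in>S. \<exists>w. is_word S m w \<and> (sim m (u \<odot> v) (a \<odot> w) \<or> sim m (u \<odot> v) (w \<odot> a))"
  using assms
proof (induction i arbitrary: u j v rule: less_induct)
  case (less i)
  note words = is_word_imp_L
  show ?case
  proof (cases "i = 1")
    case True
    then show ?thesis using less.prems sim_refl by (auto simp: is_word_1)
  next
    case False
    then obtain i1 i2 a b where ab: "is_word S i1 a" "is_word S i2 b" "1 \<le> i1" "1 \<le> i2" "i1 + i2 = i" "u = a \<odot> b"
      using less.prems by (auto elim: is_word_productE[of i u])
    have av: "is_word S (i1 + j) (a \<odot> v)"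
      using ab less.prems by (intro is_word.product)
    have uv: "sim m (u \<odot> v) ((a \<odot> v) \<odot> b)"
      unfolding ab(6) using ab less.prems words by (intro right_swap[where i = i1 and j = i2 and k = j]) auto
    show ?thesis
    proof (cases "i2 = 1")
      case True
      then have "i1 + j = m" "b \<in> S" using ab less.prems by (auto simp: is_word_1)
      then show ?thesis using av uv by blast
    next
      case False
      then obtain k1 k2 c d where cd: "is_word S k1 c" "is_word S k2 d" "1 \<le> k1" "1 \<le> k2" "k1 + k2 = i2" "b = c \<odot> d"
        using ab by (auto elim: is_word_productE[of i2 b])
      have "sim m ((a \<odot> v) \<odot> b) (c \<odot> ((a \<odot> v) \<odot> d))"
        unfolding cd(6) using ab less.prems words cd av
        by (intro left_swap[where i = "i1 + j" and j = k1 and k = k2]) auto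
      moreover have "is_word S (i1 + j + k2) ((a \<odot> v) \<odot> d)"
        using av cd ab by (intro is_word.product[OF av]) auto
      then have "\<exists>a'\<in>S. \<exists>w. is_word S m w \<and> (sim m (c \<odot> ((a \<odot> v) \<odot> d)) (a' \<odot> w) \<or> sim m (c \<odot> ((a \<odot> v) \<odot> d)) (w \<odot> a'))"
        using cd ab less.prems by (intro less.IH[of k1 c "i1 + j + k2"]) auto
      ultimately show ?thesis using uv sim_trans by meson
    qed
  qed
qed

text \<open>One outer letter is peeled off, the rest is put in alternating form by induction, and
  the letter is prepended to the list of its side.\<close>

lemma is_word_sim_altword:
  assumes "is_word S (Suc m) w" "1 \<le> m"
  obtains l r where "l \<noteq> []" "r \<noteq> []" "set l \<subseteq> S" "set r \<subseteq> S" "length l + length r = Suc m" "sim m w (altword l r)"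
  using assms
proof (induction m arbitrary: w thesis)
  case 0
  then show ?case by simp
next
  case (Suc m)
  have "2 \<le> Suc (Suc m)" by simp
  then obtain i j u v where uv: "is_word S i u" "is_word S j v" "1 \<le> i" "1 \<le> j" "i + j = Suc (Suc m)" "w = u \<odot> v"
    by (rule is_word_productE[OF Suc.prems(2)])
  show ?case
  proof (cases "m = 0")
    \<comment> \<open>Length 2 is the actual base: peeling would leave a single letter, to which the
      induction hypothesis does not apply.\<close>
    case True
    then have "i = 1" "j = 1" using uv by auto
    then have "u \<in> S" "v \<in> S" using uv by (auto simp: is_word_1)
    moreover have "w = altword [u] [v]" using uv by (simp add: altword_def)
    ultimately show ?thesis using Suc.prems(1)[of "[u]" "[v]"] True sim_refl by simp
  next
    case False
    obtain a w' where aw: "a \<in> S" "is_word S (Suc m) w'" "sim (Suc m) w (a \<odot> w') \<or> sim (Suc m) w (w' \<odot> a)"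
      using product_of_words_sim_mult_letter[OF uv(1-5)] uv(6) by blast
    obtain l r where lr: "l \<noteq> []" "r \<noteq> []" "set l \<subseteq> S" "set r \<subseteq> S" "length l + length r = Suc m" "sim m w' (altword l r)"
      using Suc.IH[OF _ aw(2)] False by auto
    from aw(3) show ?thesis
    proof
      assume "sim (Suc m) w (a \<odot> w')"
      then have "sim (Suc m) w (a \<odot> altword l r)"
        using sim_mult_left[OF lr(6) aw(1)] sim_trans by blast
      then show ?thesis
        using Suc.prems(1)[of "a # l" r] lr aw(1) altword_append_left[of l "[a]" r] by simp
    next
      assume "sim (Suc m) w (w' \<odot> a)"
      then have "sim (Suc m) w (altword l r \<odot> a)"
        using sim_mult_right[OF lr(6) aw(1)] sim_trans by blast
      moreover have "sim (Suc m) (altword l r \<odot> a) (altword l (a # r))"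
        using sim_rmul_altword[of "[a]" l r "Suc m"] lr aw(1) by simp
      ultimately have "sim (Suc m) w (altword l (a # r))" by (rule sim_trans)
      then show ?thesis
        using Suc.prems(1)[of l "a # r"] lr aw(1) by simp
    qed
  qed
qed

text \<open>Some spanning word lies outside \<open>L m S\<close>, hence has length exactly
  \<open>Suc m\<close>. Its alternating form stays outside, so neither list can repeat a
  letter.\<close>

lemma L_Suc_neq_imp_altword:
  assumes "L (Suc m) S \<noteq> L m S" "1 \<le> m"
  obtains l r where "l \<noteq> []" "r \<noteq> []" "set l \<subseteq> S" "set r \<subseteq> S" "length l + length r = Suc m"
    "altword l r \<notin> L m S" "distinct l" "distinct r"
proof -
  have "\<not> L (Suc m) S \<subseteq> L m S" using assms L_mono[of m "Suc m" S] by auto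
  then have "\<not> words_upto S (Suc m) \<subseteq> L m S"
    using span_minimal[OF _ subspace_L] by (auto simp: L_def)
  then obtain w j where w: "j \<le> Suc m" "is_word S j w" "w \<notin> L m S" by (auto simp: words_upto_def)
  have "j = Suc m"
    using w is_word_imp_L[of S j w] L_mono[of j m S] by (auto simp: le_Suc_eq)
  with w assms obtain l r where lr: "l \<noteq> []" "r \<noteq> []" "set l \<subseteq> S" "set r \<subseteq> S" "length l + length r = Suc m" "sim m w (altword l r)"
    using is_word_sim_altword by blast
  then have "altword l r \<notin> L m S" using w sim_in_L by blast
  then show thesis using that[of l r] lr altword_not_distinct by blast
qed

section \<open>Subspaces separating subwords\<close>

text \<open>\<open>U\<close> is the preimage of \<open>L m S\<close> under the completion by the
  letters \<open>as\<close> and \<open>bs\<close> missing from \<open>l'\<close> and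
  \<open>r'\<close>. The chosen subword completes to a permutation of \<open>l\<close>,
  \<open>r\<close>; any other of the same length completes to a word with a repeated letter.\<close>

lemma altword_functional:
  assumes "altword l r \<notin> L m S" "set l \<subseteq> S" "set r \<subseteq> S" "distinct l" "distinct r"
    and "length l + length r = Suc m"
    and "set l' \<subseteq> set l" "set r' \<subseteq> set r" "distinct l'" "distinct r'" "l' \<noteq> []" "r' \<noteq> []"
  shows "\<exists>U. subspace U \<and> altword l' r' \<notin> U \<and> L (length l' + length r' - 1) S \<subseteq> U \<and>
    (\<forall>l'' r''. set l'' \<subseteq> set l \<longrightarrow> set r'' \<subseteq> set r \<longrightarrow> distinct l'' \<longrightarrow> distinct r'' \<longrightarrow> l'' \<noteq> [] \<longrightarrow> r'' \<noteq> [] \<longrightarrow>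
      length l'' + length r'' = length l' + length r' \<longrightarrow> (set l'', set r'') \<noteq> (set l', set r') \<longrightarrow> altword l'' r'' \<in> U)"
proof -
  obtain as where as: "set as = set l - set l'" "distinct as"
    using finite_distinct_list[of "set l - set l'"] by auto
  obtain bs where bs: "set bs = set r - set r'" "distinct bs"
    using finite_distinct_list[of "set r - set r'"] by auto
  have "mset (as @ l') = mset l" "mset (bs @ r') = mset r"
    using as bs assms by (intro set_eq_iff_mset_eq_distinct[THEN iffD1]; auto)+
  note mset = this this[THEN mset_eq_length]
  have len: "length as + length bs + (length l' + length r') = Suc m"
    using mset(3,4) assms by simp
  have S: "set as \<subseteq> S" "set bs \<subseteq> S" "set l' \<subseteq> S" "set r' \<subseteq> S"
    using as bs assms by auto
  let ?U = "{v. lmul as (rmul bs v) \<in> L m S}"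
  show ?thesis
  proof (intro exI[of _ ?U] conjI allI impI)
    show "subspace ?U"
      using subspace_vimage_rmul[OF subspace_vimage_lmul[OF subspace_L]] by simp
    have "sim m (altword l r) (altword (as @ l') (bs @ r'))"
      using mset assms by (intro altword_perm) auto
    moreover have "sim m (altword (as @ l') (bs @ r')) (lmul as (rmul bs (altword l' r')))"
      using S assms len by (intro sim_sym[OF sim_lmul_rmul_altword]) auto
    ultimately show "altword l' r' \<notin> ?U" using assms(1) sim_in_L sim_trans by blast
    \<comment> \<open>Positivity makes the subtraction of 1 genuine, so that completing an element
      of smaller degree lands in degree \<open>m\<close>.\<close>
    have "length l' + length r' \<ge> 1" using assms by (cases l') auto
    then have "length as + (length bs + (length l' + length r' - 1)) = m" using len by simp
    then show "L (length l' + length r' - 1) S \<subseteq> ?U"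
      using lmul_in_L[OF S(1) rmul_in_L[OF S(2)]] by fastforce
  next
    fix l'' r''
    assume lr'': "set l'' \<subseteq> set l" "set r'' \<subseteq> set r" "distinct l''" "distinct r''" "l'' \<noteq> []" "r'' \<noteq> []"
      "length l'' + length r'' = length l' + length r'" "(set l'', set r'') \<noteq> (set l', set r')"
    \<comment> \<open>With equal total size, containment on both sides would force equality on both
      sides. So some letter lies outside and already occurs in \<open>as\<close> or
      \<open>bs\<close>.\<close>
    have "\<not> (set l'' \<subseteq> set l' \<and> set r'' \<subseteq> set r')"
    proof
      assume sub: "set l'' \<subseteq> set l' \<and> set r'' \<subseteq> set r'"
      have "card (set l'') + card (set r'') = card (set l') + card (set r')"
        using lr'' assms by (simp add: distinct_card)
      with sub have "card (set l'') = card (set l')" "card (set r'') = card (set r')"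
        using card_mono[of "set l'" "set l''"] card_mono[of "set r'" "set r''"] by auto
      then show False using sub lr''(8) card_subset_eq[of "set l'"] card_subset_eq[of "set r'"] by auto
    qed
    then have "\<not> distinct (as @ l'') \<or> \<not> distinct (bs @ r'')"
      using as bs lr'' by auto
    then have "altword (as @ l'') (bs @ r'') \<in> L m S"
      using S lr'' assms len by (intro altword_not_distinct) auto
    moreover have "sim m (lmul as (rmul bs (altword l'' r''))) (altword (as @ l'') (bs @ r''))"
      using S lr'' assms len by (intro sim_lmul_rmul_altword) auto
    ultimately show "altword l'' r'' \<in> ?U" using sim_in_L by blast
  qed
qed

text \<open>\<open>U\<close> collects the elements that give a lower term when put in place of
  \<open>t\<close>, moved to the innermost right position. Another letter of \<open>r\<close> is
  then repeated, and an element of \<open>L 0 S\<close> lowers the degree by one.\<close>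

lemma right_letter_functional:
  assumes "altword l r \<notin> L m S" "set l \<subseteq> S" "set r \<subseteq> S" "distinct l" "distinct r" "l \<noteq> []"
    and "length l + length r = Suc m" "t \<in> set r"
  shows "\<exists>U. subspace U \<and> t \<notin> U \<and> L 0 S \<subseteq> U \<and> set r - {t} \<subseteq> U"
proof -
  obtain as x where l: "l = as @ [x]" using assms by (metis rev_exhaust)
  let ?bs = "remove1 t r"
  let ?U = "{v. lmul as (rmul ?bs (x \<odot> v)) \<in> L m S}"
  have U: "v \<in> ?U \<longleftrightarrow> altword l (?bs @ [v]) \<in> L m S" for v
    by (simp add: l altword_snoc)
  have mset: "mset r = mset (?bs @ [t])" using assms by simp
  have len: "length r = length ?bs + 1" using mset_eq_length[OF mset] by simp
  have S: "set as \<subseteq> S" "x \<in> S" "set ?bs \<subseteq> S"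
    using assms l set_remove1_subset[of t r] by auto
  have "subspace ?U"
    using subspace_vimage_mult_right[OF subspace_vimage_rmul[OF subspace_vimage_lmul[OF subspace_L]]] by simp
  moreover have "t \<notin> ?U"
    using U[of t] assms altword_perm_right[OF mset, of l m] sim_in_L by blast
  moreover have "L 0 S \<subseteq> ?U"
  proof
    fix v assume "v \<in> L 0 S"
    then have "lmul as (rmul ?bs (x \<odot> v)) \<in> L (length as + (length ?bs + (1 + 0))) S"
      by (intro lmul_in_L rmul_in_L L_mult L_1I S)
    then show "v \<in> ?U" using len l assms by simp
  qed
  moreover have "set r - {t} \<subseteq> ?U"
  proof
    fix v assume "v \<in> set r - {t}"
    then have "\<not> distinct (?bs @ [v])" "v \<in> S" using assms by auto
    then have "altword l (?bs @ [v]) \<in> L m S"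
      using S assms len by (intro altword_not_distinct) auto
    then show "v \<in> ?U" using U by blast
  qed
  ultimately show ?thesis by blast
qed

text \<open>The mirror image, with the tested element in the innermost left position.\<close>

lemma left_letter_functional:
  assumes "altword l r \<notin> L m S" "set l \<subseteq> S" "set r \<subseteq> S" "distinct l" "distinct r" "r \<noteq> []"
    and "length l + length r = Suc m" "t \<in> set l"
  shows "\<exists>U. subspace U \<and> t \<notin> U \<and> L 0 S \<subseteq> U \<and> set l - {t} \<subseteq> U"
proof -
  obtain bs y where r: "r = bs @ [y]" using assms by (metis rev_exhaust)
  let ?as = "remove1 t l"
  let ?U = "{v. lmul ?as (rmul bs (v \<odot> y)) \<in> L m S}"
  have U: "v \<in> ?U \<longleftrightarrow> altword (?as @ [v]) r \<in> L m S" for v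
    by (simp add: r altword_snoc)
  have mset: "mset l = mset (?as @ [t])" using assms by simp
  have len: "length l = length ?as + 1" using mset_eq_length[OF mset] by simp
  have S: "set bs \<subseteq> S" "y \<in> S" "set ?as \<subseteq> S"
    using assms r set_remove1_subset[of t l] by auto
  have "subspace ?U"
    using subspace_vimage_mult_left[OF subspace_vimage_rmul[OF subspace_vimage_lmul[OF subspace_L]]] by simp
  moreover have "t \<notin> ?U"
    using U[of t] assms altword_perm_left[OF mset, of r m] sim_in_L by blast
  moreover have "L 0 S \<subseteq> ?U"
  proof
    fix v assume "v \<in> L 0 S"
    then have "lmul ?as (rmul bs (v \<odot> y)) \<in> L (length ?as + (length bs + (0 + 1))) S"
      by (intro lmul_in_L rmul_in_L L_mult L_1I S)
    then show "v \<in> ?U" using len r assms by simp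
  qed
  moreover have "set l - {t} \<subseteq> ?U"
  proof
    fix v assume "v \<in> set l - {t}"
    then have "\<not> distinct (?as @ [v])" "v \<in> S" using assms by auto
    then have "altword (?as @ [v]) r \<in> L m S"
      using S assms len by (intro altword_not_distinct) auto
    then show "v \<in> ?U" using U by blast
  qed
  ultimately show ?thesis by blast
qed

end

text \<open>
  Labels for the independent family. Sets of letters suffice for the words: reordering the
  factors only changes the sign modulo lower terms.
\<close>

datatype 'a index = Unity 'a | Letter 'a | Word "'a set" "'a set"

section \<open>The dimension count\<close>

locale fin_dim_descendingly_alternative_algebra =
  descendingly_alternative_algebra scale mult S + finite_dimensional_vector_space scale Basis
  for scale :: "'f::field \<Rightarrow> 'a::ab_group_add \<Rightarrow> 'a"  (infixr \<open>*s\<close> 75)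
    and mult :: "'a \<Rightarrow> 'a \<Rightarrow> 'a"  (infixl \<open>\<odot>\<close> 70)
    and S :: "'a set"
    and Basis :: "'a set"
begin

definition enum :: "'a set \<Rightarrow> 'a list"
  where "enum X = (SOME xs. set xs = X \<and> distinct xs)"

lemma enum:
  assumes "finite X"
  shows "set (enum X) = X" "distinct (enum X)" "length (enum X) = card X"
proof -
  have "set (enum X) = X \<and> distinct (enum X)"
    unfolding enum_def using finite_distinct_list[OF assms] by (rule someI_ex)
  then show "set (enum X) = X" "distinct (enum X)" "length (enum X) = card X"
    using distinct_card[of "enum X"] by auto
qed

fun element :: "'a index \<Rightarrow> 'a" where
  "element (Unity e) = e"
| "element (Letter t) = t"
| "element (Word A B) = altword (enum A) (enum B)"

fun degree :: "'a index \<Rightarrow> nat" where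
  "degree (Unity e) = 0"
| "degree (Letter t) = 1"
| "degree (Word A B) = card A + card B"

lemma unity_unique: "is_unity e \<Longrightarrow> is_unity e' \<Longrightarrow> e = e'"
  unfolding is_unity_def by metis

lemma card_unities: "finite unities" "card unities = d0"
proof -
  have "unities = {e}" if "is_unity e" for e
    using that unity_unique by (auto simp: unities_def)
  moreover have "unities = {}" if "\<not> unital"
    using that by (auto simp: unities_def unital_def)
  ultimately show "finite unities" "card unities = d0"
    by (auto simp: d0_def unital_def) (metis finite.intros finite_insert unities_def unital_def)+
qed

lemma altword_count_le_dim:
  assumes "altword l r \<notin> L m S" "set l \<subseteq> S" "set r \<subseteq> S" "distinct l" "distinct r" "l \<noteq> []" "r \<noteq> []"
    and "length l + length r = Suc m"
  shows "d0 + max (length l) (length r) + (2 ^ length l - 1) * (2 ^ length r - 1) \<le> dim UNIV"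
proof -
  \<comment> \<open>\<open>T\<close> is the letter set of the longer list. Only one list is used,
    because the separating subspace of a letter is known to contain just the other letters of its
    own list.\<close>
  obtain T where T: "finite T" "card T = max (length l) (length r)" "T \<subseteq> S"
    and letter: "\<And>t. t \<in> T \<Longrightarrow> \<exists>U. subspace U \<and> t \<notin> U \<and> L 0 S \<subseteq> U \<and> T - {t} \<subseteq> U"
  proof (cases "length l \<le> length r")
    case True
    then show ?thesis
      using that[of "set r"] right_letter_functional[of l r m] assms by (simp add: distinct_card)
  next
    case False
    then show ?thesis
      using that[of "set l"] left_letter_functional[of l r m] assms by (simp add: distinct_card)
  qed
  \<comment> \<open>Empty sets are removed because \<open>altword\<close> takes the last entry of
    each list.\<close>
  define W where "W = (\<lambda>(A, B). Word A B) ` ((Pow (set l) - {{}}) \<times> (Pow (set r) - {{}}))"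
  define I where "I = Unity ` unities \<union> Letter ` T \<union> W"
  have "inj_on (\<lambda>(A, B). Word A B) X" for X :: "('a set \<times> 'a set) set"
    by (auto simp: inj_on_def)
  then have "card W = (2 ^ length l - 1) * (2 ^ length r - 1)"
    unfolding W_def using assms by (simp add: card_image card_Diff_subset card_Pow distinct_card)
  moreover have "finite W" by (simp add: W_def)
  moreover have "card (Unity ` unities) = d0" "card (Letter ` T) = max (length l) (length r)"
    using T card_unities by (simp_all add: card_image inj_on_def)
  moreover have "Unity ` unities \<inter> Letter ` T = {}" "(Unity ` unities \<union> Letter ` T) \<inter> W = {}"
    by (auto simp: W_def)
  ultimately have cardI: "finite I" "card I = d0 + max (length l) (length r) + (2 ^ length l - 1) * (2 ^ length r - 1)"
    using T card_unities by (simp_all add: I_def card_Un_disjoint)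
  have WordD: "set (enum A) \<subseteq> set l" "set (enum B) \<subseteq> set r" "distinct (enum A)" "distinct (enum B)"
    "enum A \<noteq> []" "enum B \<noteq> []" "length (enum A) = card A" "length (enum B) = card B"
    "set (enum A) = A" "set (enum B) = B"
    if "Word A B \<in> I" for A B
  proof -
    have AB: "A \<subseteq> set l" "B \<subseteq> set r" "A \<noteq> {}" "B \<noteq> {}" using that by (auto simp: I_def W_def)
    then have "finite A" "finite B" using finite_subset by auto
    note en = enum[OF this(1)] enum[OF this(2)]
    with AB show "set (enum A) \<subseteq> set l" "set (enum B) \<subseteq> set r" "distinct (enum A)" "distinct (enum B)"
      "enum A \<noteq> []" "enum B \<noteq> []" "length (enum A) = card A" "length (enum B) = card B"
      "set (enum A) = A" "set (enum B) = B" by auto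
  qed
  have LetterD: "t \<in> T" if "Letter t \<in> I" for t using that by (auto simp: I_def W_def)
  have UnityD: "e \<in> unities" if "Unity e \<in> I" for e using that by (auto simp: I_def W_def)
  have Word_degree: "2 \<le> card A + card B" if "Word A B \<in> I" for A B
    using WordD[OF that] by (metis Suc_leI add_mono length_greater_0_conv one_add_one One_nat_def)
  have element_in_L: "element i \<in> L (degree i) S" if "i \<in> I" for i
  proof (cases i)
    case (Unity e)
    then show ?thesis using UnityD[of e] that unities_subset_L by auto
  next
    case (Letter t)
    then show ?thesis using LetterD[of t] that T L_1I by auto
  next
    case (Word A B)
    then show ?thesis
      using WordD[of A B] that assms altword_in_L[of "enum A" "enum B"] by auto
  qed
  have "card I \<le> dim UNIV"
  proof (rule card_le_dim_triangular[where w = element and d = degree])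
    fix i assume i: "i \<in> I"
    show "\<exists>U. subspace U \<and> element i \<notin> U \<and> (\<forall>j\<in>I. j \<noteq> i \<longrightarrow> degree j \<le> degree i \<longrightarrow> element j \<in> U)"
    proof (cases i)
      case (Unity e)
      have "e \<noteq> 0"
      proof
        \<comment> \<open>A zero unity makes the whole algebra zero, contradicting that
          \<open>altword l r\<close> is outside \<open>L m S\<close>.\<close>
        assume "e = 0"
        then have "a = 0" for a :: 'a
          using UnityD[of e] i Unity mult_zero_left[of a] by (auto simp: unities_def is_unity_def)
        then show False using assms(1) subspace_0[OF subspace_L[of m S]] by metis
      qed
      \<comment> \<open>Letters have degree 1 and words at least 2, so degree 0 leaves only the
        unity, and the zero subspace will serve as \<open>U\<close>.\<close>
      moreover have "j = i" if "j \<in> I" "degree j \<le> degree i" for j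
      proof (cases j)
        case (Unity e')
        then have "is_unity e" "is_unity e'"
          using that i \<open>i = Unity e\<close> UnityD by (auto simp: unities_def)
        then show ?thesis using Unity \<open>i = Unity e\<close> unity_unique by simp
      next
        case (Word A B)
        then show ?thesis using that Unity Word_degree[of A B] by simp
      qed (use that Unity in simp)
      ultimately show ?thesis using Unity by (intro exI[of _ "{0}"]) auto
    next
      case (Letter t)
      with i obtain U where U: "subspace U" "t \<notin> U" "L 0 S \<subseteq> U" "T - {t} \<subseteq> U"
        using letter LetterD by blast
      have "element j \<in> U" if "j \<in> I" "j \<noteq> i" "degree j \<le> degree i" for j
      proof (cases j)
        case (Unity e)
        then show ?thesis using that U element_in_L[of j] by auto
      next
        case (Letter t')
        then show ?thesis using that U LetterD[of t'] \<open>i = Letter t\<close> by auto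
      next
        case (Word A B)
        then show ?thesis using that Letter Word_degree[of A B] by simp
      qed
      then show ?thesis using Letter U by auto
    next
      case (Word A B)
      note AB = WordD[of A B] Word_degree[of A B]
      obtain U where U: "subspace U" "altword (enum A) (enum B) \<notin> U" "L (card A + card B - 1) S \<subseteq> U"
        and kill: "\<And>l'' r''. set l'' \<subseteq> set l \<Longrightarrow> set r'' \<subseteq> set r \<Longrightarrow> distinct l'' \<Longrightarrow> distinct r'' \<Longrightarrow>
          l'' \<noteq> [] \<Longrightarrow> r'' \<noteq> [] \<Longrightarrow> length l'' + length r'' = card A + card B \<Longrightarrow>
          (set l'', set r'') \<noteq> (A, B) \<Longrightarrow> altword l'' r'' \<in> U"
        using altword_functional[OF assms(1-5,8), of "enum A" "enum B"] AB i Word by auto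
      have "element j \<in> U" if j: "j \<in> I" "j \<noteq> i" "degree j \<le> degree i" for j
      proof (cases "degree j = degree i")
        case True
        \<comment> \<open>A word has degree at least 2, so no unity or letter shares its
          degree.\<close>
        then obtain A' B' where j': "j = Word A' B'"
          using Word AB(11) i by (cases j) (simp_all)
        have "altword (enum A') (enum B') \<in> U"
          using WordD[OF j(1)[unfolded j']] j(2) j' Word True by (intro kill) simp_all
        then show ?thesis by (simp add: j')
      next
        case False
        then have "degree j \<le> card A + card B - 1" using j Word by auto
        from L_mono[OF this] show ?thesis using element_in_L[OF j(1)] U(3) by blast
      qed
      then show ?thesis using Word U by auto
    qed
  qed (rule cardI)
  then show ?thesis using cardI by simp
qed

lemma L_Suc_neq_imp_le_dim:
  assumes "L (Suc m) S \<noteq> L m S" "1 \<le> m"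
  shows "2 ^ m + int (Suc m) - 2 \<le> int (dim UNIV) - int d0"
proof -
  obtain l r where lr: "l \<noteq> []" "r \<noteq> []" "set l \<subseteq> S" "set r \<subseteq> S" "length l + length r = Suc m"
    "altword l r \<notin> L m S" "distinct l" "distinct r"
    using L_Suc_neq_imp_altword[OF assms] by blast
  have "d0 + max (length l) (length r) + (2 ^ length l - 1) * (2 ^ length r - 1) \<le> dim UNIV"
    by (rule altword_count_le_dim[OF lr(6,3,4,7,8,1,2,5)])
  \<comment> \<open>Each power is at least 1, so the truncated subtractions agree with those of
    integers.\<close>
  moreover have "int ((2 ^ length l - 1) * (2 ^ length r - 1)) = (2 ^ length l - 1) * (2 ^ length r - 1)"
    by (simp add: of_nat_diff)
  moreover have "1 \<le> length l" "1 \<le> length r" using lr by (auto simp: Suc_le_eq)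
  ultimately show ?thesis
    using length_count_bound[of "length l" "length r", unfolded lr(5) diff_Suc_1] by linarith
qed

section \<open>From the filtration to the length\<close>

text \<open>The filtration is increasing and the basis finite, so the largest of the indices
  capturing the basis vectors suffices. This ensures that the \<open>LEAST\<close> in
  \<open>set_length\<close> is attained.\<close>

lemma generating_imp_L_eq_UNIV:
  assumes "generating S"
  obtains k where "L k S = UNIV"
proof -
  have "\<exists>k. b \<in> L k S" for b
  proof -
    have "b \<in> L_infty S" using assms by (simp add: generating_def)
    then show ?thesis by (simp add: L_infty_def)
  qed
  then obtain k where k: "b \<in> L (k b) S" for b by metis
  \<comment> \<open>For an empty basis this value is unspecified, but the inclusion below is then
    vacuous.\<close>
  let ?k = "Max (k ` Basis)"
  have "Basis \<subseteq> L ?k S"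
  proof
    fix b assume "b \<in> Basis"
    then have "k b \<le> ?k" using finite_Basis by (intro Max_ge) auto
    then show "b \<in> L ?k S" using k[of b] L_mono by blast
  qed
  then have "L ?k S = UNIV"
    using span_minimal[OF _ subspace_L, of Basis ?k S] span_Basis by auto
  then show thesis by (rule that)
qed

lemma set_length_le_dim:
  assumes "generating S" "2 \<le> set_length S"
  shows "2 ^ (set_length S - 1) + int (set_length S) - 2 \<le> int (dim UNIV) - int d0"
proof -
  have inf: "L_infty S = UNIV" using assms by (simp add: generating_def)
  obtain k where "L k S = UNIV" using generating_imp_L_eq_UNIV[OF assms(1)] .
  then have "L (set_length S) S = UNIV"
    unfolding set_length_def inf by (rule LeastI[of "\<lambda>k. L k S = UNIV"])
  \<comment> \<open>Minimality makes the last step of the filtration strict, which is what the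
    dimension bound requires.\<close>
  moreover have "L (set_length S - 1) S \<noteq> UNIV"
    using not_less_Least[of "set_length S - 1" "\<lambda>k. L k S = UNIV"] assms(2)
    unfolding set_length_def inf by auto
  ultimately show ?thesis
    using L_Suc_neq_imp_le_dim[of "set_length S - 1"] assms(2) by simp
qed

end

theorem theorem4p5:
  fixes scale :: "'f::field \<Rightarrow> 'a::ab_group_add \<Rightarrow> 'a"
    and mult :: "'a \<Rightarrow> 'a \<Rightarrow> 'a"
    and Basis :: "'a set"
    and n :: nat
  assumes "nonassoc_algebra scale mult"
    and "finite_dimensional_vector_space scale Basis"
    and "nonassoc_algebra.descendingly_alternative scale mult"
    and "n = nonassoc_algebra.alg_length scale mult"
    and "n \<ge> 2"
  shows "int (vector_space.dim scale (UNIV :: 'a set)) - int (nonassoc_algebra.d0 mult)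
           \<ge> 2 ^ (n - 1) + int n - 2"
proof -
  interpret nonassoc_algebra scale mult by fact
  interpret finite_dimensional_vector_space scale Basis by fact
  have bound: "2 ^ (set_length S - 1) + int (set_length S) - 2 \<le> int (dim UNIV) - int d0"
    if "generating S" "2 \<le> set_length S" for S
  proof -
    interpret fin_dim_descendingly_alternative_algebra scale mult S Basis
      by unfold_locales fact
    show ?thesis using that by (rule set_length_le_dim)
  qed
  let ?lengths = "{set_length S | S. generating S}"
  \<comment> \<open>A crude consequence of the bound itself, used to see that the maximum is over a
    finite set.\<close>
  have "set_length S \<le> dim UNIV + 2" if "generating S" for S
  proof (cases "2 \<le> set_length S")
    case True
    have "(1::int) \<le> 2 ^ (set_length S - 1)" by simp
    then show ?thesis using bound[OF that True] by linarith
  qed simp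
  then have "finite ?lengths"
    by (intro finite_subset[of ?lengths "{..dim UNIV + 2}"]) auto
  \<comment> \<open>The whole algebra generates itself, so the maximum is over a nonempty
    set.\<close>
  moreover have "x \<in> L_infty UNIV" for x
    using L_1I[of x UNIV] by (auto simp: L_infty_def)
  then have "generating UNIV" by (auto simp: generating_def)
  then have "?lengths \<noteq> {}" by blast
  ultimately have "alg_length \<in> ?lengths"
    unfolding alg_length_def by (rule Max_in)
  then obtain S where "generating S" "n = set_length S" using assms(4) by auto
  then show ?thesis using bound[of S] assms(5) by simp
qed

end
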